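(* Let $T:\ell_1\to\ell_1$ be an onto linear isometry. Then $T$ is a signed permutation operator, i.e., there exist a bijection $\sigma:\mathbb{N}\to\mathbb{N}$ and scalars $c_n\in\mathbb{K}$ with $|c_n|=1$ for every $n\in\mathbb{N}$ such that $T(x)=(c_nx_{\sigma(n)})_{n\in\mathbb{N}}$ for every $x=(x_n)_{n\in\mathbb{N}}\in\ell_1$.
   Context: $\mathbb{K}$ is $\mathbb{R}$ or $\mathbb{C}$, and $\ell_1$ is the space of absolutely summable sequences in $\mathbb{K}$ with norm $\|x\|_1=\sum_n|x_n|$. *)

theory Defs
  imports "HOL-Analysis.Analysis"
begin

typedef (overloaded) ('k::real_normed_field) ell1 =
    "{x :: nat \<Rightarrow> 'k. summable (\<lambda>n. norm (x n))}"
  morphisms ell1_nth Abs_ell1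
  by (intro exI[of _ "\<lambda>_. 0"]) simp

setup_lifting type_definition_ell1

lemma summable_norm_ell1: "summable (\<lambda>n. norm (ell1_nth x n))"
  using ell1_nth[of x] by simp

lemma ell1_eqI: "(\<And>n. ell1_nth x n = ell1_nth y n) \<Longrightarrow> x = y"
  by transfer auto

lift_definition ell1_scale :: "'k::real_normed_field \<Rightarrow> 'k ell1 \<Rightarrow> 'k ell1"
  is "\<lambda>a x n. a * x n"
  by (simp add: norm_mult summable_mult)

lemma summable_norm_add:
  fixes x y :: "nat \<Rightarrow> 'a::real_normed_vector"
  assumes "summable (\<lambda>n. norm (x n))" "summable (\<lambda>n. norm (y n))"
  shows "summable (\<lambda>n. norm (x n + y n))"
  by (rule summable_comparison_test'[OF summable_add[OF assms], where N = 0])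
    (simp add: norm_triangle_ineq)

instantiation ell1 :: (real_normed_field) real_normed_vector
begin

lift_definition zero_ell1 :: "'a ell1" is "\<lambda>_. 0"
  by simp

lift_definition plus_ell1 :: "'a ell1 \<Rightarrow> 'a ell1 \<Rightarrow> 'a ell1" is "\<lambda>x y n. x n + y n"
  by (rule summable_norm_add)

lift_definition minus_ell1 :: "'a ell1 \<Rightarrow> 'a ell1 \<Rightarrow> 'a ell1" is "\<lambda>x y n. x n - y n"
  using summable_norm_add[of _ "\<lambda>n. - y n" for y] by simp

lift_definition uminus_ell1 :: "'a ell1 \<Rightarrow> 'a ell1" is "\<lambda>x n. - x n"
  by simp

lift_definition scaleR_ell1 :: "real \<Rightarrow> 'a ell1 \<Rightarrow> 'a ell1" is "\<lambda>r x n. r *\<^sub>R x n"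
  by (simp add: summable_mult)

lift_definition norm_ell1 :: "'a ell1 \<Rightarrow> real" is "\<lambda>x. \<Sum>n. norm (x n)" .

definition dist_ell1 :: "'a ell1 \<Rightarrow> 'a ell1 \<Rightarrow> real"
  where "dist_ell1 x y = norm (x - y)"

definition sgn_ell1 :: "'a ell1 \<Rightarrow> 'a ell1"
  where "sgn_ell1 x = inverse (norm x) *\<^sub>R x"

definition uniformity_ell1 :: "('a ell1 \<times> 'a ell1) filter"
  where "uniformity_ell1 = (INF e\<in>{0<..}. principal {(x, y). dist x y < e})"

definition open_ell1 :: "'a ell1 set \<Rightarrow> bool"
  where "open_ell1 U \<longleftrightarrow> (\<forall>x\<in>U. eventually (\<lambda>(x', y). x' = x \<longrightarrow> y \<in> U) uniformity)"

instance
proof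
  fix x y z :: "'a ell1" and r s :: real
  show "x + y + z = x + (y + z)" "x + y = y + x" "0 + x = x" "- x + x = 0" "x - y = x + - y"
    by (transfer; simp add: algebra_simps)+
  show "r *\<^sub>R (x + y) = r *\<^sub>R x + r *\<^sub>R y" "(r + s) *\<^sub>R x = r *\<^sub>R x + s *\<^sub>R x"
    "r *\<^sub>R s *\<^sub>R x = (r * s) *\<^sub>R x" "1 *\<^sub>R x = x"
    by (transfer; simp add: algebra_simps)+
  show "dist x y = norm (x - y)" "sgn x = inverse (norm x) *\<^sub>R x"
    "(uniformity :: ('a ell1 \<times> 'a ell1) filter)
      = (INF e\<in>{0<..}. principal {(x, y). dist x y < e})"
    by (simp_all add: dist_ell1_def sgn_ell1_def uniformity_ell1_def)
  show "open U = (\<forall>x\<in>U. \<forall>\<^sub>F (x', y) in uniformity. x' = x \<longrightarrow> y \<in> U)" for U :: "'a ell1 set"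
    by (simp add: open_ell1_def)
  show "(norm x = 0) = (x = 0)"
    by transfer (auto simp: suminf_eq_zero_iff)
  show "norm (x + y) \<le> norm x + norm y"
  proof transfer
    fix x y :: "nat \<Rightarrow> 'a"
    assume x: "summable (\<lambda>n. norm (x n))" and y: "summable (\<lambda>n. norm (y n))"
    have "(\<Sum>n. norm (x n + y n)) \<le> (\<Sum>n. norm (x n) + norm (y n))"
      using x y by (intro suminf_le norm_triangle_ineq summable_norm_add summable_add)
    then show "(\<Sum>n. norm (x n + y n)) \<le> (\<Sum>n. norm (x n)) + (\<Sum>n. norm (y n))"
      by (simp add: suminf_add[OF x y])
  qed
  show "norm (r *\<^sub>R x) = \<bar>r\<bar> * norm x"
    by transfer (simp add: suminf_mult)
qed

end

lemma vector_space_ell1_scale: "vector_space ell1_scale"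
  by unfold_locales (transfer; simp add: algebra_simps)+

lemma scaleR_ell1_eq: "r *\<^sub>R x = ell1_scale (of_real r) x"
  by transfer (simp add: scaleR_conv_of_real)

lemma norm_ell1_scale: "norm (ell1_scale a x) = norm a * norm x"
  by transfer (simp add: norm_mult suminf_mult)

(* Linearity is over the scalar field 'k itself, hence complex-linearity for 'k = complex;
   the constant linear of Real_Vector_Spaces would only give real-linearity. *)
definition onto_linear_isometry :: "('k::real_normed_field ell1 \<Rightarrow> 'k ell1) \<Rightarrow> bool"
  where "onto_linear_isometry T \<longleftrightarrow>
    Vector_Spaces.linear ell1_scale ell1_scale T \<and> surj T \<and> (\<forall>x y. dist (T x) (T y) = dist x y)"

definition signed_permutation_operator :: "('k::real_normed_field ell1 \<Rightarrow> 'k ell1) \<Rightarrow> bool"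
  where "signed_permutation_operator T \<longleftrightarrow>
    (\<exists>(\<sigma> :: nat \<Rightarrow> nat) (c :: nat \<Rightarrow> 'k). bij \<sigma> \<and> (\<forall>n. norm (c n) = 1) \<and>
      (\<forall>x n. ell1_nth (T x) n = c n * ell1_nth x (\<sigma> n)))"

end

theory Submission
  imports Defs
begin

text \<open>
  The proof rests on the fact that the norm of \<open>\<ell>\<^sub>1\<close> detects whether two sequences have disjoint
  supports: this happens if and only if
  \<open>\<parallel>x + y\<parallel> = \<parallel>x - y\<parallel> = \<parallel>x\<parallel> + \<parallel>y\<parallel>\<close> (\<open>disjoint_support_iff_norm\<close>). Indeed, equality of the sums
  forces the same two equalities in every coordinate, and in an inner product space the
  parallelogram law then makes one of the two coordinates vanish. A linear isometry \<open>T\<close> hence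
  preserves and reflects disjointness of supports.

  A coordinate can be expressed by disjointness as well: \<open>x\<close> vanishes at \<open>k\<close> if and only if \<open>x\<close> and
  the unit vector \<open>e\<^sub>k\<close> are disjoint. If \<open>T e\<^sub>n\<close> had two points \<open>p \<noteq> q\<close> in its support, then both
  \<open>T\<^sup>-\<^sup>1 e\<^sub>p\<close> and \<open>T\<^sup>-\<^sup>1 e\<^sub>q\<close> would be nonzero at \<open>n\<close>, although they are disjoint since \<open>e\<^sub>p\<close> and \<open>e\<^sub>q\<close>
  are. So \<open>T e\<^sub>n\<close> is a multiple of one unit vector, at a position \<open>\<tau> n\<close>, and \<open>\<tau>\<close> is a bijection.
  Finally \<open>x - x\<^sub>n e\<^sub>n\<close> is disjoint from \<open>e\<^sub>n\<close>, so its image vanishes at \<open>\<tau> n\<close>; thus the value of \<open>T x\<close>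
  at \<open>\<tau> n\<close> is \<open>x\<^sub>n\<close> times that of \<open>T e\<^sub>n\<close>.

  The real and the complex numbers are both normed fields whose norm comes from a real inner
  product, so one proof over such fields covers the two cases.
\<close>

lemma zero_if_norm_add_diff_eq:
  fixes a b :: "'a::real_inner"
  assumes "norm (a + b) = norm a + norm b" and "norm (a - b) = norm a + norm b"
  shows "a = 0 \<or> b = 0"
proof -
  have "(norm (a + b))\<^sup>2 + (norm (a - b))\<^sup>2 = 2 * (norm a)\<^sup>2 + 2 * (norm b)\<^sup>2"
    by (simp add: power2_norm_eq_inner inner_add_left inner_add_right inner_diff_left
        inner_diff_right)
  then have "norm a * norm b = 0"
    unfolding assms by (simp add: power2_eq_square algebra_simps)
  then show ?thesis by simp
qed

lemma ell1_nth_simps [simp]: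
  "ell1_nth 0 n = 0"
  "ell1_nth (x + y) n = ell1_nth x n + ell1_nth y n"
  "ell1_nth (x - y) n = ell1_nth x n - ell1_nth y n"
  "ell1_nth (ell1_scale a x) n = a * ell1_nth x n"
  by (transfer; simp)+

definition disjoint_support :: "'k::real_normed_field ell1 \<Rightarrow> 'k ell1 \<Rightarrow> bool"
  where "disjoint_support x y \<longleftrightarrow> (\<forall>n. ell1_nth x n = 0 \<or> ell1_nth y n = 0)"

text \<open>
  Equality in the triangle inequality of \<open>\<ell>\<^sub>1\<close> means equality in every coordinate, because the
  coordinatewise defects are nonnegative and sum to \<open>0\<close>.
\<close>

lemma norm_add_eq_iff_ell1:
  "norm (x + y) = norm x + norm y \<longleftrightarrow>
    (\<forall>n. norm (ell1_nth x n + ell1_nth y n) = norm (ell1_nth x n) + norm (ell1_nth y n))"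
proof -
  let ?d = "\<lambda>n. norm (ell1_nth x n) + norm (ell1_nth y n) - norm (ell1_nth x n + ell1_nth y n)"
  note summables = summable_norm_ell1[of x] summable_norm_ell1[of y]
  have xy: "summable (\<lambda>n. norm (ell1_nth x n + ell1_nth y n))"
    using summable_norm_ell1[of "x + y"] by simp
  have s: "summable ?d"
    using summables xy by (intro summable_diff summable_add)
  have "suminf ?d = norm x + norm y - norm (x + y)"
    using summables xy
    by (simp add: norm_ell1.rep_eq suminf_diff [symmetric] suminf_add summable_add)
  then have "norm (x + y) = norm x + norm y \<longleftrightarrow> suminf ?d = 0"
    by auto
  also have "\<dots> \<longleftrightarrow> (\<forall>n. ?d n = 0)"
    using s by (rule suminf_eq_zero_iff) (simp add: norm_triangle_ineq)
  finally show ?thesis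
    by (auto simp: algebra_simps)
qed

lemma norm_diff_eq_iff_ell1:
  "norm (x - y) = norm x + norm y \<longleftrightarrow>
    (\<forall>n. norm (ell1_nth x n - ell1_nth y n) = norm (ell1_nth x n) + norm (ell1_nth y n))"
  using norm_add_eq_iff_ell1[of x "- y"] by (simp add: uminus_ell1.rep_eq)

lemma disjoint_support_iff_norm:
  fixes x y :: "'k::{real_normed_field, real_inner} ell1"
  shows "disjoint_support x y \<longleftrightarrow>
    norm (x + y) = norm x + norm y \<and> norm (x - y) = norm x + norm y"
  unfolding norm_add_eq_iff_ell1 norm_diff_eq_iff_ell1 disjoint_support_def
  by (metis add.left_neutral add.right_neutral diff_zero diff_0 norm_minus_cancel norm_zero
      zero_if_norm_add_diff_eq)

lift_definition unit_ell1 :: "nat \<Rightarrow> 'k::real_normed_field ell1"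
  is "\<lambda>k n. if n = k then 1 else 0"
  by (rule summable_finite[of "{k}" for k]) auto

lemma ell1_nth_unit [simp]: "ell1_nth (unit_ell1 k) n = (if n = k then 1 else 0)"
  by transfer simp

lemma norm_eq_nth_if_singleton_support:
  assumes "\<And>n. n \<noteq> k \<Longrightarrow> ell1_nth x n = 0"
  shows "norm x = norm (ell1_nth x k)"
  unfolding norm_ell1.rep_eq using assms by (subst suminf_finite[of "{k}"]) auto

lemma norm_unit_ell1: "norm (unit_ell1 k :: 'k::real_normed_field ell1) = 1"
  by (subst norm_eq_nth_if_singleton_support[of k]) auto

text \<open>
  This turns statements about coordinates into statements about disjointness, which isometries
  respect.
\<close>

lemma disjoint_support_unit_iff: "disjoint_support x (unit_ell1 k) \<longleftrightarrow> ell1_nth x k = 0"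
  by (auto simp: disjoint_support_def)

theorem onto_linear_isometry_imp_signed_permutation:
  fixes T :: "'k::{real_normed_field, real_inner} ell1 \<Rightarrow> 'k ell1"
  assumes "onto_linear_isometry T"
  shows "signed_permutation_operator T"
proof -
  interpret T: Vector_Spaces.linear ell1_scale ell1_scale T
    using assms by (simp add: onto_linear_isometry_def)
  have surj: "surj T" and dist: "\<And>x y. dist (T x) (T y) = dist x y"
    using assms by (simp_all add: onto_linear_isometry_def)
  have norm: "norm (T x) = norm x" for x
    using dist[of x 0] T.zero by simp
  have disjoint: "disjoint_support (T x) (T y) \<longleftrightarrow> disjoint_support x y" for x y
    unfolding disjoint_support_iff_norm
    by (simp only: T.add [symmetric] T.diff [symmetric] norm)
  obtain S where TS: "\<And>y. T (S y) = y"
    using surj by (metis surjD)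

  let ?e = "unit_ell1 :: nat \<Rightarrow> 'k ell1"
  \<comment> \<open>The zero pattern of the matrix of \<open>T\<close> is the transpose of that of its inverse \<open>S\<close>.\<close>
  have support_swap: "ell1_nth (T (?e n)) p = 0 \<longleftrightarrow> ell1_nth (S (?e p)) n = 0" for n p
  proof -
    have "ell1_nth (T (?e n)) p = 0 \<longleftrightarrow> disjoint_support (T (?e n)) (T (S (?e p)))"
      by (simp add: TS disjoint_support_unit_iff)
    also have "\<dots> \<longleftrightarrow> disjoint_support (S (?e p)) (?e n)"
      unfolding disjoint by (auto simp: disjoint_support_def)
    finally show ?thesis
      by (simp add: disjoint_support_unit_iff)
  qed
  have image_unit_unique: "p = q"
    if "ell1_nth (T (?e n)) p \<noteq> 0" and "ell1_nth (T (?e n)) q \<noteq> 0" for n p q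
  proof (rule ccontr)
    assume "p \<noteq> q"
    then have "disjoint_support (T (S (?e p))) (T (S (?e q)))"
      by (simp add: TS disjoint_support_unit_iff)
    then have "disjoint_support (S (?e p)) (S (?e q))"
      unfolding disjoint .
    then show False
      using that unfolding support_swap disjoint_support_def by blast
  qed
  have "\<exists>p. ell1_nth (T (?e n)) p \<noteq> 0" for n
  proof (rule ccontr)
    assume "\<not> ?thesis"
    then have "T (?e n) = 0"
      by (intro ell1_eqI) simp
    then show False
      using norm[of "?e n"] by (simp add: norm_unit_ell1)
  qed
  then obtain \<tau> where \<tau>: "\<And>n. ell1_nth (T (?e n)) (\<tau> n) \<noteq> 0"
    by metis
  define d where "d n = ell1_nth (T (?e n)) (\<tau> n)" for n
  have norm_d: "norm (d n) = 1" for n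
  proof -
    have "ell1_nth (T (?e n)) m = 0" if "m \<noteq> \<tau> n" for m
      using that image_unit_unique \<tau> by blast
    then have "norm (T (?e n)) = norm (d n)"
      unfolding d_def by (rule norm_eq_nth_if_singleton_support)
    then show ?thesis
      by (simp add: norm norm_unit_ell1)
  qed

  have "inj \<tau>"
  proof (rule injI, rule ccontr)
    fix m n
    assume "\<tau> m = \<tau> n" and "m \<noteq> n"
    then have "disjoint_support (T (?e m)) (T (?e n))"
      unfolding disjoint by (simp add: disjoint_support_unit_iff)
    then show False
      using \<tau>[of m] \<tau>[of n] \<open>\<tau> m = \<tau> n\<close> unfolding disjoint_support_def by metis
  qed
  moreover have "surj \<tau>"
  proof -
    have "\<exists>n. p = \<tau> n" for p
    proof -
      have "S (?e p) \<noteq> 0"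
        using TS[of "?e p"] norm_unit_ell1[of p, where 'k = 'k] by (metis T.zero norm_zero zero_neq_one)
      then obtain n where "ell1_nth (S (?e p)) n \<noteq> 0"
        by (metis ell1_eqI ell1_nth_simps(1))
      then show ?thesis
        using image_unit_unique \<tau> support_swap by blast
    qed
    then show ?thesis
      unfolding surj_def by blast
  qed
  ultimately have bij: "bij \<tau>"
    by (rule bijI)

  have nth_T: "ell1_nth (T x) (\<tau> n) = d n * ell1_nth x n" for x n
  proof -
    \<comment> \<open>Removing the \<open>n\<close>-th coordinate of \<open>x\<close> leaves a sequence disjoint from \<open>e\<^sub>n\<close>.\<close>
    let ?r = "x - ell1_scale (ell1_nth x n) (?e n)"
    have "disjoint_support (T ?r) (T (?e n))"
      unfolding disjoint by (simp add: disjoint_support_unit_iff)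
    then have "ell1_nth (T ?r) (\<tau> n) = 0"
      using \<tau> unfolding disjoint_support_def by blast
    then show ?thesis
      by (simp add: T.diff T.scale d_def)
  qed
  let ?\<sigma> = "inv \<tau>"
  show ?thesis
    unfolding signed_permutation_operator_def
  proof (intro exI conjI allI)
    show "bij ?\<sigma>"
      using bij by (rule bij_imp_bij_inv)
    show "norm (d (?\<sigma> n)) = 1" for n
      by (rule norm_d)
    show "ell1_nth (T x) n = d (?\<sigma> n) * ell1_nth x (?\<sigma> n)" for x n
      using nth_T[of x "?\<sigma> n"] \<open>surj \<tau>\<close> by (simp add: surj_f_inv_f)
  qed
qed

theorem corollary3p8:
  shows "(\<forall>T :: real ell1 \<Rightarrow> real ell1.
            onto_linear_isometry T \<longrightarrow> signed_permutation_operator T) \<and>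
         (\<forall>T :: complex ell1 \<Rightarrow> complex ell1.
            onto_linear_isometry T \<longrightarrow> signed_permutation_operator T)"
  by (simp add: onto_linear_isometry_imp_signed_permutation)

end
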